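(* Let $T=\{u,v,w\}$ be a non-exceptional triangle in a quasi-thin scheme $(\Omega,S)$. Then there exist $a\in u^*w$ and $b\in w^*v$ such that $|ab\cap u^*v|=1$.
   Context: A scheme is a pair $(\Omega,S)$ with $\Omega$ finite, $S$ a partition of $\Omega\times\Omega$ with $1_\Omega\in S$, $S$ closed under transposition $r\mapsto r^*$, and $|\alpha u\cap\gamma v^*|$ independent of $(\alpha,\gamma)\in w$ for $u,v,w\in S$. Quasi-thin: every basic relation $u$ has valency $|\alpha u|\in\{1,2\}$; $S_2$ is the set of valency-$2$ relations. For $x,y\in S$, $xy$ denotes the set of basic relations contained in the relational product $x\cdot y$. For $u\in S_2$ there is a unique basic relation $u^\perp$ with $uu^*=\{1_\Omega,u^\perp\}$. Distinct $u,v\in S_2$ are adjacent if $|u^*v|=2$; a triangle is a $3$-subset of $S_2$ any two distinct elements of which are adjacent; a triangle $\{u,v,w\}$ is exceptional if $u^\perp\cdot v^\perp\cdot w^\perp=1_\Omega$. *)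

theory Defs
  imports Main "HOL-Library.Disjoint_Sets"
begin

text \<open>
  Relations on \<open>\<Omega>\<close> are sets of pairs: \<open>r\<^sup>*\<close> is \<^term>\<open>r\<inverse>\<close>, the relational product
  \<open>x \<cdot> y\<close> is \<^term>\<open>x O y\<close>, the neighbourhood \<open>\<alpha>u\<close> is \<^term>\<open>u `` {\<alpha>}\<close>, and
  \<open>1\<^sub>\<Omega>\<close> is \<^term>\<open>Id_on \<Omega>\<close>. The blocks of a \<^const>\<open>partition_on\<close> are nonempty,
  so a scheme has nonempty \<open>\<Omega>\<close>.
\<close>

definition scheme :: "'a set \<Rightarrow> 'a rel set \<Rightarrow> bool" where
  "scheme \<Omega> S \<longleftrightarrow>
     finite \<Omega> \<and>
     partition_on (\<Omega> \<times> \<Omega>) S \<and>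
     Id_on \<Omega> \<in> S \<and>
     (\<forall>r\<in>S. r\<inverse> \<in> S) \<and>
     (\<forall>u\<in>S. \<forall>v\<in>S. \<forall>w\<in>S. \<exists>c::nat. \<forall>(\<alpha>, \<gamma>)\<in>w.
        card (u `` {\<alpha>} \<inter> (v\<inverse>) `` {\<gamma>}) = c)"

definition quasi_thin :: "'a set \<Rightarrow> 'a rel set \<Rightarrow> bool" where
  "quasi_thin \<Omega> S \<longleftrightarrow>
     scheme \<Omega> S \<and> (\<forall>u\<in>S. \<forall>\<alpha>\<in>\<Omega>. card (u `` {\<alpha>}) \<in> {1, 2})"

definition S2 :: "'a set \<Rightarrow> 'a rel set \<Rightarrow> 'a rel set" where
  "S2 \<Omega> S = {u \<in> S. \<forall>\<alpha>\<in>\<Omega>. card (u `` {\<alpha>}) = 2}"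

definition basic_prod :: "'a rel set \<Rightarrow> 'a rel \<Rightarrow> 'a rel \<Rightarrow> 'a rel set" where
  "basic_prod S x y = {t \<in> S. t \<subseteq> x O y}"

text \<open>
  The description is meaningful for \<open>u \<in> S2 \<Omega> S\<close> in a quasi-thin scheme, where such a
  basic relation exists and is unique.
\<close>

definition orth :: "'a set \<Rightarrow> 'a rel set \<Rightarrow> 'a rel \<Rightarrow> 'a rel" where
  "orth \<Omega> S u = (THE t. t \<in> S \<and> basic_prod S u (u\<inverse>) = {Id_on \<Omega>, t})"

definition adjacent :: "'a set \<Rightarrow> 'a rel set \<Rightarrow> 'a rel \<Rightarrow> 'a rel \<Rightarrow> bool" where
  "adjacent \<Omega> S u v \<longleftrightarrow>
     u \<in> S2 \<Omega> S \<and> v \<in> S2 \<Omega> S \<and> u \<noteq> v \<and> card (basic_prod S (u\<inverse>) v) = 2"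

definition triangle :: "'a set \<Rightarrow> 'a rel set \<Rightarrow> 'a rel set \<Rightarrow> bool" where
  "triangle \<Omega> S T \<longleftrightarrow>
     T \<subseteq> S2 \<Omega> S \<and> card T = 3 \<and> (\<forall>x\<in>T. \<forall>y\<in>T. x \<noteq> y \<longrightarrow> adjacent \<Omega> S x y)"

text \<open>
  A condition on the triangle with elements \<open>u, v, w\<close>. It does not depend on their order:
  each \<open>orth \<Omega> S x\<close> is symmetric, and if the product is \<open>1\<^sub>\<Omega>\<close> then the three
  factors are (graphs of) involutions, each being the product of the other two in either order.
\<close>

definition exceptional :: "'a set \<Rightarrow> 'a rel set \<Rightarrow> 'a rel \<Rightarrow> 'a rel \<Rightarrow> 'a rel \<Rightarrow> bool" where
  "exceptional \<Omega> S u v w \<longleftrightarrow> orth \<Omega> S u O orth \<Omega> S v O orth \<Omega> S w = Id_on \<Omega>"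

end

(* Fix a point \<alpha>. Adjacency of u and v says that the relations of u* v are two complementary perfect
   matchings between \<alpha>u and \<alpha>v. If the claim fails, then ab contains all of u* v for all choices of
   a and b. Now let \<alpha> \<noteq> \<beta> have a common u-neighbour x, and \<beta> \<noteq> \<delta> a common v-neighbour y, that is,
   (\<alpha>,\<beta>) lies in orth u and (\<beta>,\<delta>) in orth v. For z in \<alpha>w, let y' be the point of \<alpha>v that is in the
   same relation to x as y, and let b be the relation of w* v that does not contain (z,y').
   Regularity forces (z,y) to be in b, so z and y have a common neighbour along w and v; it can only be \<delta>.
   Hence \<alpha>w = \<delta>w, the only point in relation orth w to \<delta> is \<alpha>, and the triangle is exceptional. *)

theory Submission imports Defs begin

section \<open>Basic relations and intersection numbers of a scheme\<close>

lemma basic_relation_unique: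
  assumes "scheme \<Omega> S" "r \<in> S" "s \<in> S" "(p, q) \<in> r" "(p, q) \<in> s"
  shows "r = s"
  using assms unfolding scheme_def partition_on_def disjoint_def by blast

lemma basic_relation_exists:
  assumes "scheme \<Omega> S" "p \<in> \<Omega>" "q \<in> \<Omega>"
  obtains r where "r \<in> S" "(p, q) \<in> r"
  using assms unfolding scheme_def partition_on_def by blast

lemma basic_relation_subset:
  assumes "scheme \<Omega> S" "r \<in> S"
  shows "r \<subseteq> \<Omega> \<times> \<Omega>"
  using assms unfolding scheme_def partition_on_def by blast

lemma basic_relation_converse:
  assumes "scheme \<Omega> S" "r \<in> S"
  shows "r\<inverse> \<in> S"
  using assms unfolding scheme_def by blast

lemma finite_neighbourhood:
  assumes "scheme \<Omega> S" "r \<in> S"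
  shows "finite (r `` A)"
  using basic_relation_subset[OF assms] assms(1) unfolding scheme_def
  by (blast intro: finite_subset)

lemma card_intersection_eq:
  assumes "scheme \<Omega> S" "r \<in> S" "s \<in> S" "t \<in> S" "(p, q) \<in> r" "(p', q') \<in> r"
  shows "card (s `` {p} \<inter> (t\<inverse>) `` {q}) = card (s `` {p'} \<inter> (t\<inverse>) `` {q'})"
proof -
  obtain c where "\<forall>(\<alpha>, \<gamma>)\<in>r. card (s `` {\<alpha>} \<inter> (t\<inverse>) `` {\<gamma>}) = c"
    using assms unfolding scheme_def by meson
  then have "card (s `` {\<alpha>} \<inter> (t\<inverse>) `` {\<gamma>}) = c" if "(\<alpha>, \<gamma>) \<in> r" for \<alpha> \<gamma>
    using that by blast
  then show ?thesis using assms(5,6) by metis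
qed

text \<open>The number of intermediate points between the ends of a pair in \<open>r\<close> is an
  intersection number, so if it is positive at one pair of \<open>r\<close> it is positive at all of
  them.\<close>

lemma basic_relation_transfer:
  assumes "scheme \<Omega> S" "r \<in> S" "s \<in> S" "t \<in> S"
    and "(p, q) \<in> r" "(p, m) \<in> s" "(m, q) \<in> t" "(p', q') \<in> r"
  obtains m' where "(p', m') \<in> s" "(m', q') \<in> t"
proof -
  have "finite (s `` {p} \<inter> (t\<inverse>) `` {q})"
    using finite_neighbourhood[OF assms(1,3)] by blast
  moreover have "m \<in> s `` {p} \<inter> (t\<inverse>) `` {q}" using assms by blast
  ultimately have "card (s `` {p} \<inter> (t\<inverse>) `` {q}) \<noteq> 0" by auto
  hence "card (s `` {p'} \<inter> (t\<inverse>) `` {q'}) \<noteq> 0"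
    using card_intersection_eq[OF assms(1-5,8)] by simp
  hence "s `` {p'} \<inter> (t\<inverse>) `` {q'} \<noteq> {}" by (metis card.empty)
  thus ?thesis using that by blast
qed

text \<open>By transfer of the intermediate point, a single path decides that a whole basic relation
  lies in the product.\<close>

lemma mem_basic_prod:
  assumes "scheme \<Omega> S" "r \<in> S" "s \<in> S" "t \<in> S"
    and "(p, q) \<in> r" "(p, m) \<in> s" "(m, q) \<in> t"
  shows "r \<in> basic_prod S s t"
proof -
  have "(p', q') \<in> s O t" if "(p', q') \<in> r" for p' q'
    using basic_relation_transfer[OF assms that] by blast
  thus ?thesis using assms(2) unfolding basic_prod_def by auto
qed

section \<open>Neighbourhoods and the relation \<open>orth\<close> in quasi-thin schemes\<close>

lemma quasi_thin_neighbours: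
  assumes "quasi_thin \<Omega> S" "r \<in> S" "(p, x) \<in> r" "(p, y) \<in> r" "(p, z) \<in> r" "x \<noteq> y"
  shows "z = x \<or> z = y"
proof (rule ccontr)
  assume "\<not> (z = x \<or> z = y)"
  hence "card {x, y, z} = 3" using assms(6) by auto
  moreover have s: "scheme \<Omega> S" using assms(1) unfolding quasi_thin_def by blast
  hence "card {x, y, z} \<le> card (r `` {p})"
    using assms(2-5) by (intro card_mono finite_neighbourhood[OF s]) auto
  moreover have "p \<in> \<Omega>" using basic_relation_subset[OF s assms(2)] assms(3) by blast
  hence "card (r `` {p}) \<in> {1, 2}" using assms(1,2) unfolding quasi_thin_def by blast
  ultimately show False by auto
qed

lemma quasi_thin_neighbours_converse:
  assumes "quasi_thin \<Omega> S" "r \<in> S" "(x, p) \<in> r" "(y, p) \<in> r" "(z, p) \<in> r" "x \<noteq> y"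
  shows "z = x \<or> z = y"
proof -
  have "r\<inverse> \<in> S"
    using assms(1,2) basic_relation_converse unfolding quasi_thin_def by blast
  from quasi_thin_neighbours[OF assms(1) this] assms show ?thesis by blast
qed

text \<open>Counting: \<open>u\<close> has twice as many pairs as \<Omega> has points, so
  \<open>snd\<close> cannot be injective on it. This is the source of the non-identity relation in
  \<open>u O u\<inverse>\<close>.\<close>

lemma S2_common_neighbour_exists:
  assumes "scheme \<Omega> S" "u \<in> S2 \<Omega> S"
  obtains p q x where "p \<noteq> q" "(p, x) \<in> u" "(q, x) \<in> u"
proof -
  have u2: "card (u `` {p}) = 2" if "p \<in> \<Omega>" for p
    using assms(2) that unfolding S2_def by auto
  have \<Omega>: "finite \<Omega>" "\<Omega> \<noteq> {}"
    using assms(1) unfolding scheme_def partition_on_def by auto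
  have uS: "u \<in> S" using assms(2) unfolding S2_def by blast
  have sub: "u \<subseteq> \<Omega> \<times> \<Omega>" by (rule basic_relation_subset[OF assms(1) uS])
  have "card (Sigma \<Omega> (\<lambda>p. u `` {p})) = card \<Omega> * 2"
    using \<Omega> u2 finite_neighbourhood[OF assms(1) uS] by (simp add: card_SigmaI)
  moreover have "Sigma \<Omega> (\<lambda>p. u `` {p}) = u" using sub by auto
  moreover have "card \<Omega> > 0" using \<Omega> by (simp add: card_gt_0_iff)
  ultimately have "card u > card \<Omega>" by simp
  moreover have "snd ` u \<subseteq> \<Omega>" using sub by auto
  ultimately have "\<not> inj_on snd u"
    using \<Omega>(1) by (metis card_inj_on_le not_le)
  then obtain e f where "e \<in> u" "f \<in> u" "snd e = snd f" "e \<noteq> f"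
    unfolding inj_on_def by blast
  then show ?thesis using that by (cases e, cases f) auto
qed

text \<open>Replaces the definite description in \<open>orth\<close> by a pointwise condition. The
  relation \<open>t\<close> of one pair of distinct points with a common \<open>u\<close>-neighbour
  contains every such pair, because a point has at most two predecessors under
  \<open>u\<close>.\<close>

lemma
  assumes "quasi_thin \<Omega> S" "u \<in> S2 \<Omega> S"
  shows mem_orth_iff: "(p, q) \<in> orth \<Omega> S u \<longleftrightarrow> p \<noteq> q \<and> (\<exists>x. (p, x) \<in> u \<and> (q, x) \<in> u)"
    and orth_total: "p \<in> \<Omega> \<Longrightarrow> \<exists>q. (p, q) \<in> orth \<Omega> S u"
proof -
  have s: "scheme \<Omega> S" using assms(1) unfolding quasi_thin_def by blast
  have uS: "u \<in> S" using assms(2) unfolding S2_def by blast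
  note sub = basic_relation_subset[OF s uS]
  note uS' = basic_relation_converse[OF s uS]
  have IdS: "Id_on \<Omega> \<in> S" using s unfolding scheme_def by blast
  have total: "\<exists>x. (p, x) \<in> u" if "p \<in> \<Omega>" for p
  proof -
    have "card (u `` {p}) = 2" using assms(2) that unfolding S2_def by blast
    hence "u `` {p} \<noteq> {}" by (metis card.empty zero_neq_numeral)
    thus ?thesis by blast
  qed
  obtain p0 q0 x0 where 0: "p0 \<noteq> q0" "(p0, x0) \<in> u" "(q0, x0) \<in> u"
    using S2_common_neighbour_exists[OF s assms(2)] .
  obtain t where t: "t \<in> S" "(p0, q0) \<in> t"
    using basic_relation_exists[OF s] 0 sub by blast
  have tId: "p \<noteq> q" if "(p, q) \<in> t" for p q
  proof
    assume "p = q"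
    moreover have "p \<in> \<Omega>" using basic_relation_subset[OF s t(1)] that by blast
    ultimately have "t = Id_on \<Omega>"
      using basic_relation_unique[OF s t(1) IdS that] by blast
    with t 0 show False by auto
  qed
  have tu: "t \<in> basic_prod S u (u\<inverse>)"
    using mem_basic_prod[OF s t(1) uS uS' t(2) 0(2)] 0(3) by blast
  have partner: "\<exists>q. (p, q) \<in> t \<and> (q, x) \<in> u" if "(p, x) \<in> u" for p x
    using basic_relation_transfer[OF s uS t(1) uS 0(2) t(2) 0(3) that] by blast
  \<comment> \<open>\<open>partner\<close> supplies a \<open>t\<close>-successor of \<open>p\<close>
    among the predecessors of \<open>x\<close>; it is not \<open>p\<close> by \<open>tId\<close>, so
    it is \<open>q\<close>.\<close>
  have in_t: "(p, q) \<in> t" if "p \<noteq> q" "(p, x) \<in> u" "(q, x) \<in> u" for p q x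
    using partner[OF that(2)] tId quasi_thin_neighbours_converse[OF assms(1) uS that(2,3)] that(1)
    by blast
  have "Id_on \<Omega> \<in> basic_prod S u (u\<inverse>)"
    using IdS total unfolding basic_prod_def by auto
  moreover have "r = Id_on \<Omega> \<or> r = t" if r: "r \<in> basic_prod S u (u\<inverse>)" for r
  proof -
    have rS: "r \<in> S" using r unfolding basic_prod_def by blast
    have "r \<noteq> {}" using s rS unfolding scheme_def partition_on_def by blast
    then obtain p q x where pq: "(p, q) \<in> r" "(p, x) \<in> u" "(q, x) \<in> u"
      using r unfolding basic_prod_def by fastforce
    show ?thesis
    proof (cases "p = q")
      case True
      hence "(p, q) \<in> Id_on \<Omega>" using pq sub by blast
      thus ?thesis using basic_relation_unique[OF s rS IdS pq(1)] by blast
    next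
      case False
      thus ?thesis using basic_relation_unique[OF s rS t(1) pq(1)] in_t pq by blast
    qed
  qed
  ultimately have prod: "basic_prod S u (u\<inverse>) = {Id_on \<Omega>, t}" using tu by blast
  have orth: "orth \<Omega> S u = t"
    unfolding orth_def prod
  proof (rule the_equality)
    show "t \<in> S \<and> {Id_on \<Omega>, t} = {Id_on \<Omega>, t}" using t by blast
    show "r = t" if "r \<in> S \<and> {Id_on \<Omega>, t} = {Id_on \<Omega>, r}" for r
      using that by (metis doubleton_eq_iff)
  qed
  have "t \<subseteq> u O u\<inverse>" using tu unfolding basic_prod_def by blast
  then show "(p, q) \<in> orth \<Omega> S u \<longleftrightarrow> p \<noteq> q \<and> (\<exists>x. (p, x) \<in> u \<and> (q, x) \<in> u)"
    unfolding orth using in_t tId by blast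
  show "\<exists>q. (p, q) \<in> orth \<Omega> S u" if "p \<in> \<Omega>"
    unfolding orth using total[OF that] partner by blast
qed

lemma adjacent_matching:
  assumes "scheme \<Omega> S" "adjacent \<Omega> S u v" "a \<in> S"
    and "(p, x) \<in> u" "(p, y) \<in> v" "(p, y') \<in> v" "(x, y) \<in> a" "(x, y') \<in> a"
  shows "y = y'"
proof (rule ccontr)
  assume ne: "y \<noteq> y'"
  have uS: "u \<in> S" and vS: "v \<in> S" and v2: "\<And>p. p \<in> \<Omega> \<Longrightarrow> card (v `` {p}) = 2"
    and two: "card (basic_prod S (u\<inverse>) v) = 2"
    using assms(2) unfolding adjacent_def S2_def by auto
  note aS' = basic_relation_converse[OF assms(1,3)]
  have fin: "finite (v `` {q})" for q by (rule finite_neighbourhood[OF assms(1) vS])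
  have "card {y, y'} \<le> card (v `` {p} \<inter> ((a\<inverse>)\<inverse>) `` {x})"
    using assms fin by (intro card_mono) auto
  hence ge: "card (v `` {p} \<inter> ((a\<inverse>)\<inverse>) `` {x}) \<ge> 2" using ne by simp
  have all: "(x', y'') \<in> a" if "(q, x') \<in> u" "(q, y'') \<in> v" for q x' y''
  proof -
    have "q \<in> \<Omega>" using that basic_relation_subset[OF assms(1) uS] by blast
    then have "card (v `` {q}) \<le> card (v `` {q} \<inter> ((a\<inverse>)\<inverse>) `` {x'})"
      using ge v2 card_intersection_eq[OF assms(1) uS vS aS' assms(4) that(1)] by simp
    then have "v `` {q} \<inter> ((a\<inverse>)\<inverse>) `` {x'} = v `` {q}"
      using fin by (intro card_seteq) auto
    thus ?thesis using that by blast
  qed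
  have "basic_prod S (u\<inverse>) v \<subseteq> {a}"
  proof
    fix r assume r: "r \<in> basic_prod S (u\<inverse>) v"
    then have rS: "r \<in> S" and "r \<subseteq> u\<inverse> O v" unfolding basic_prod_def by auto
    then have "r \<subseteq> a" using all by blast
    moreover have "r \<noteq> {}" using assms(1) rS unfolding scheme_def partition_on_def by blast
    ultimately show "r \<in> {a}" using basic_relation_unique[OF assms(1) rS assms(3)] by fastforce
  qed
  then have "card (basic_prod S (u\<inverse>) v) \<le> card {a}" by (rule card_mono[rotated]) simp
  thus False using two by simp
qed

section \<open>Non-exceptional triangles\<close>

theorem theorem7p3:
  fixes \<Omega> :: "'a set" and S :: "'a rel set" and u v w :: "'a rel"
  assumes "quasi_thin \<Omega> S"
    and "triangle \<Omega> S {u, v, w}"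
    and "\<not> exceptional \<Omega> S u v w"
  shows "\<exists>a \<in> basic_prod S (u\<inverse>) w. \<exists>b \<in> basic_prod S (w\<inverse>) v.
           card (basic_prod S a b \<inter> basic_prod S (u\<inverse>) v) = 1"
proof (rule ccontr)
  assume contra: "\<not> ?thesis"
  note qt = assms(1)
  have s: "scheme \<Omega> S" using qt unfolding quasi_thin_def by blast
  have "u \<noteq> v" "u \<noteq> w" "w \<noteq> v"
    using assms(2) unfolding triangle_def by (auto simp: card_insert_if split: if_splits)
  then have uv: "adjacent \<Omega> S u v" and uw: "adjacent \<Omega> S u w" and wv: "adjacent \<Omega> S w v"
    and u2: "u \<in> S2 \<Omega> S" and v2: "v \<in> S2 \<Omega> S" and w2: "w \<in> S2 \<Omega> S"
    using assms(2) unfolding triangle_def by auto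
  have uS: "u \<in> S" and vS: "v \<in> S" and wS: "w \<in> S" using u2 v2 w2 unfolding S2_def by auto
  note uniq = basic_relation_unique[OF s]
  note conv = basic_relation_converse[OF s]
  have \<Omega>: "p \<in> \<Omega>" "q \<in> \<Omega>" if "(p, q) \<in> r" "r \<in> S" for p q r
    using basic_relation_subset[OF s that(2)] that(1) by auto
  have common: "\<exists>r\<in>basic_prod S (f\<inverse>) g. (x, y) \<in> r"
    if fg: "f \<in> S" "g \<in> S" "(p, x) \<in> f" "(p, y) \<in> g" for f g p x y
  proof -
    obtain r where r: "r \<in> S" "(x, y) \<in> r"
      using basic_relation_exists[OF s \<Omega>(2)[OF fg(3,1)] \<Omega>(2)[OF fg(4,2)]] by blast
    have "r \<in> basic_prod S (f\<inverse>) g"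
      using fg by (intro mem_basic_prod[OF s r(1) conv[OF fg(1)] fg(2) r(2)]) auto
    with r show ?thesis by blast
  qed
  \<comment> \<open>The intersection is never empty: a \<open>b\<close>-pair can be moved to start
    at the end \<open>z\<close> of an \<open>a\<close>-pair over the same base point
    \<open>p\<close>, and the relation \<open>c\<close> of the resulting ends lies in both products.
    Not having exactly one element, it has both elements of the product of
    \<open>u\<inverse>\<close> and \<open>v\<close>.\<close>
  have full: "basic_prod S (u\<inverse>) v \<subseteq> basic_prod S a b"
    if a: "a \<in> basic_prod S (u\<inverse>) w" and b: "b \<in> basic_prod S (w\<inverse>) v" for a b
  proof -
    have aS: "a \<in> S" and bS: "b \<in> S" using a b unfolding basic_prod_def by auto
    have "a \<noteq> {}" "b \<noteq> {}" using s aS bS unfolding scheme_def partition_on_def by auto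
    then obtain p x z where 1: "(x, z) \<in> a" "(p, x) \<in> u" "(p, z) \<in> w"
      using a unfolding basic_prod_def by fastforce
    obtain p' z' y' where 2: "(z', y') \<in> b" "(p', z') \<in> w" "(p', y') \<in> v"
      using \<open>b \<noteq> {}\<close> b unfolding basic_prod_def by fastforce
    have "(y', z') \<in> b\<inverse>" using 2 by blast
    from basic_relation_transfer[OF s wS vS conv[OF bS] 2(2,3) this 1(3)]
    obtain y where y: "(p, y) \<in> v" "(z, y) \<in> b" by blast
    obtain c where c: "c \<in> basic_prod S (u\<inverse>) v" "(x, y) \<in> c"
      using common[OF uS vS 1(2) y(1)] by blast
    then have cS: "c \<in> S" unfolding basic_prod_def by blast
    have cc: "c \<in> basic_prod S a b" using mem_basic_prod[OF s cS aS bS c(2) 1(1) y(2)] .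
    let ?I = "basic_prod S a b \<inter> basic_prod S (u\<inverse>) v"
    have two: "card (basic_prod S (u\<inverse>) v) = 2" using uv unfolding adjacent_def by blast
    \<comment> \<open>Finiteness comes from the cardinality 2, since \<open>card\<close> of an
      infinite set is 0.\<close>
    then have fin: "finite (basic_prod S (u\<inverse>) v)" using card.infinite by fastforce
    have "card ?I \<noteq> 1" using contra a b by blast
    moreover have "card ?I \<noteq> 0" using fin c cc by auto
    ultimately have "card ?I \<ge> card (basic_prod S (u\<inverse>) v)" using two by linarith
    then have "?I = basic_prod S (u\<inverse>) v" using fin by (intro card_seteq) auto
    thus ?thesis by blast
  qed
  have other: "\<exists>b\<in>basic_prod S (w\<inverse>) v. b \<noteq> r" for r
  proof (rule ccontr)
    assume "\<not> ?thesis"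
    then have "basic_prod S (w\<inverse>) v \<subseteq> {r}" by blast
    then have "card (basic_prod S (w\<inverse>) v) \<le> card {r}" by (rule card_mono[rotated]) simp
    thus False using wv unfolding adjacent_def by simp
  qed
  have v_total: "\<exists>y. (p, y) \<in> v" if "p \<in> \<Omega>" for p
    using orth_total[OF qt v2 that] mem_orth_iff[OF qt v2] by blast
  \<comment> \<open>Take \<open>b\<close> avoiding \<open>(z, y)\<close>. By \<open>full\<close>
    there is still a path from \<open>x\<close> through some \<open>z'\<close> to \<open>y\<close>
    along \<open>a\<close> and \<open>b\<close>. Over \<alpha> or over \<beta>, \<open>z'\<close>
    and \<open>z\<close> are both matched to \<open>x\<close> by \<open>a\<close>, so they coincide,
    a contradiction.\<close>
  have w_disjoint: False
    if ab: "\<alpha> \<noteq> \<beta>" "(\<alpha>, x) \<in> u" "(\<beta>, x) \<in> u" "(\<alpha>, z) \<in> w" "(\<beta>, z) \<in> w" for \<alpha> \<beta> x z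
  proof -
    obtain y where y: "(\<alpha>, y) \<in> v" using v_total \<Omega>(1)[OF ab(2) uS] by blast
    obtain a where a: "a \<in> basic_prod S (u\<inverse>) w" "(x, z) \<in> a"
      using common[OF uS wS ab(2,4)] by blast
    obtain r where r: "r \<in> basic_prod S (w\<inverse>) v" "(z, y) \<in> r"
      using common[OF wS vS ab(4) y] by blast
    obtain c where c: "c \<in> basic_prod S (u\<inverse>) v" "(x, y) \<in> c"
      using common[OF uS vS ab(2) y] by blast
    obtain b where b: "b \<in> basic_prod S (w\<inverse>) v" "b \<noteq> r" using other by blast
    have "(x, y) \<in> a O b" using full[OF a(1) b(1)] c unfolding basic_prod_def by blast
    then obtain z' where z': "(x, z') \<in> a" "(z', y) \<in> b" by blast
    obtain \<gamma> where \<gamma>: "(\<gamma>, x) \<in> u" "(\<gamma>, z') \<in> w" using z'(1) a unfolding basic_prod_def by blast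
    have aS: "a \<in> S" using a unfolding basic_prod_def by blast
    have "\<gamma> = \<alpha> \<or> \<gamma> = \<beta>"
      using quasi_thin_neighbours_converse[OF qt uS ab(2,3) \<gamma>(1) ab(1)] .
    then have "z' = z"
      using adjacent_matching[OF s uw aS ab(2) _ ab(4) z'(1) a(2)]
        adjacent_matching[OF s uw aS ab(3) _ ab(5) z'(1) a(2)] \<gamma>(2) by blast
    then have "(z, y) \<in> b" using z'(2) by simp
    then show False using uniq[OF _ _ _ r(2)] b r(1) unfolding basic_prod_def by blast
  qed
  have key: "\<alpha> \<noteq> \<delta> \<and> (\<delta>, z) \<in> w"
    if ab: "\<alpha> \<noteq> \<beta>" "(\<alpha>, x) \<in> u" "(\<beta>, x) \<in> u"
      and bd: "\<beta> \<noteq> \<delta>" "(\<beta>, y) \<in> v" "(\<delta>, y) \<in> v" and z: "(\<alpha>, z) \<in> w" for \<alpha> \<beta> \<delta> x y z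
  proof -
    obtain a where a: "a \<in> basic_prod S (u\<inverse>) w" "(x, z) \<in> a"
      using common[OF uS wS ab(2) z] by blast
    obtain c where c: "c \<in> basic_prod S (u\<inverse>) v" "(x, y) \<in> c"
      using common[OF uS vS ab(3) bd(2)] by blast
    have aS: "a \<in> S" and cS: "c \<in> S" using a c unfolding basic_prod_def by auto
    from basic_relation_transfer[OF s uS vS conv[OF cS] ab(3) bd(2) _ ab(2)] c(2)
    obtain y' where y': "(\<alpha>, y') \<in> v" "(x, y') \<in> c" by blast
    obtain r where r: "r \<in> basic_prod S (w\<inverse>) v" "(z, y') \<in> r"
      using common[OF wS vS z y'(1)] by blast
    obtain b where b: "b \<in> basic_prod S (w\<inverse>) v" "b \<noteq> r" using other by blast
    have bS: "b \<in> S" using b unfolding basic_prod_def by blast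
    have "(x, y) \<in> a O b" using full[OF a(1) b(1)] c unfolding basic_prod_def by blast
    then obtain z0 where z0: "(x, z0) \<in> a" "(z0, y) \<in> b" by blast
    \<comment> \<open>The path through \<open>z0\<close> is moved along \<open>a\<close> so that it
      passes through the given \<open>z\<close>; its end \<open>y''\<close> is then shown to be
      \<open>y\<close>.\<close>
    from basic_relation_transfer[OF s aS cS conv[OF bS] z0(1) c(2) _ a(2)] z0(2)
    obtain y'' where y'': "(x, y'') \<in> c" "(z, y'') \<in> b" by blast
    have "r \<in> S" using r unfolding basic_prod_def by blast
    then have ne: "y'' \<noteq> y'" using uniq[OF bS _ y''(2)] r(2) b(2) by blast
    obtain \<gamma> where \<gamma>: "(\<gamma>, x) \<in> u" "(\<gamma>, y'') \<in> v" using y''(1) c unfolding basic_prod_def by blast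
    \<comment> \<open>The matching \<open>c\<close> sends \<open>x\<close> to \<open>y'\<close> over
      \<alpha> and to \<open>y\<close> over \<beta>. As \<open>y''\<close> differs from
      \<open>y'\<close>, it lies over \<beta>.\<close>
    have "\<gamma> = \<alpha> \<or> \<gamma> = \<beta>"
      using quasi_thin_neighbours_converse[OF qt uS ab(2,3) \<gamma>(1) ab(1)] .
    moreover have "\<gamma> \<noteq> \<alpha>"
      using adjacent_matching[OF s uv cS ab(2) _ y'(1) y''(1) y'(2)] \<gamma> ne by blast
    ultimately have yy: "y'' = y"
      using adjacent_matching[OF s uv cS ab(3) _ bd(2) y''(1) c(2)] \<gamma> by blast
    \<comment> \<open>If they were equal, \<open>y\<close> and \<open>y'\<close> would be two points
      over \<alpha> matched to \<open>x\<close> by \<open>c\<close>.\<close>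
    have "\<alpha> \<noteq> \<delta>"
      using adjacent_matching[OF s uv cS ab(2) _ y'(1) c(2) y'(2)] bd(3) ne yy by blast
    moreover obtain \<epsilon> where \<epsilon>: "(\<epsilon>, z) \<in> w" "(\<epsilon>, y) \<in> v"
      using y''(2) b yy unfolding basic_prod_def by blast
    moreover have "\<epsilon> = \<beta> \<or> \<epsilon> = \<delta>"
      using quasi_thin_neighbours_converse[OF qt vS bd(2,3) \<epsilon>(2) bd(1)] .
    \<comment> \<open>The case \<epsilon> = \<beta> is excluded, since \<alpha> and \<beta> already
      share the \<open>u\<close>-neighbour \<open>x\<close> and would also share
      \<open>z\<close>.\<close>
    ultimately show ?thesis using w_disjoint[OF ab z] by blast
  qed
  have closed: "\<epsilon> = \<alpha>"
    if orth: "(\<alpha>, \<beta>) \<in> orth \<Omega> S u" "(\<beta>, \<delta>) \<in> orth \<Omega> S v" "(\<delta>, \<epsilon>) \<in> orth \<Omega> S w" for \<alpha> \<beta> \<delta> \<epsilon>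
  proof -
    obtain x where x: "\<alpha> \<noteq> \<beta>" "(\<alpha>, x) \<in> u" "(\<beta>, x) \<in> u"
      using orth(1) mem_orth_iff[OF qt u2] by blast
    obtain y where y: "\<beta> \<noteq> \<delta>" "(\<beta>, y) \<in> v" "(\<delta>, y) \<in> v"
      using orth(2) mem_orth_iff[OF qt v2] by blast
    obtain z where z: "\<delta> \<noteq> \<epsilon>" "(\<delta>, z) \<in> w" "(\<epsilon>, z) \<in> w"
      using orth(3) mem_orth_iff[OF qt w2] by blast
    have "w `` {\<alpha>} \<subseteq> w `` {\<delta>}" using key[OF x y] by blast
    moreover have "card (w `` {\<alpha>}) = card (w `` {\<delta>})"
      using w2 \<Omega>(1)[OF x(2) uS] \<Omega>(1)[OF z(2) wS] unfolding S2_def by simp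
    ultimately have "w `` {\<alpha>} = w `` {\<delta>}"
      using card_subset_eq finite_neighbourhood[OF s wS] by metis
    then have "(\<alpha>, z) \<in> w" using z(2) by blast
    \<comment> \<open>Now \<alpha>, \<delta> and \<epsilon> all precede \<open>z\<close> under
      \<open>w\<close>, which allows only two predecessors. Both \<alpha> and \<epsilon> differ from
      \<delta>, so they agree.\<close>
    then show ?thesis
      using quasi_thin_neighbours_converse[OF qt wS z(2,3) _ z(1)] key[OF x y] by blast
  qed
  have orth_\<Omega>: "p \<in> \<Omega>" "q \<in> \<Omega>" if "(p, q) \<in> orth \<Omega> S f" "f \<in> S2 \<Omega> S" for p q f
    using iffD1[OF mem_orth_iff[OF qt that(2)] that(1)] \<Omega>(1)[of _ _ f] that(2)
    unfolding S2_def by blast+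
  have "orth \<Omega> S u O orth \<Omega> S v O orth \<Omega> S w = Id_on \<Omega>"
  proof
    show "orth \<Omega> S u O orth \<Omega> S v O orth \<Omega> S w \<subseteq> Id_on \<Omega>"
      using closed orth_\<Omega>(1)[OF _ u2] by blast
    \<comment> \<open>Each factor is total, so a path of three steps starts at every point, and
      \<open>closed\<close> makes it return there.\<close>
    show "Id_on \<Omega> \<subseteq> orth \<Omega> S u O orth \<Omega> S v O orth \<Omega> S w"
    proof
      fix e assume "e \<in> Id_on \<Omega>"
      then obtain \<alpha> where \<alpha>: "\<alpha> \<in> \<Omega>" "e = (\<alpha>, \<alpha>)" by blast
      obtain \<beta> where \<beta>: "(\<alpha>, \<beta>) \<in> orth \<Omega> S u" using orth_total[OF qt u2 \<alpha>(1)] by blast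
      obtain \<delta> where \<delta>: "(\<beta>, \<delta>) \<in> orth \<Omega> S v"
        using orth_total[OF qt v2 orth_\<Omega>(2)[OF \<beta> u2]] by blast
      obtain \<epsilon> where \<epsilon>: "(\<delta>, \<epsilon>) \<in> orth \<Omega> S w"
        using orth_total[OF qt w2 orth_\<Omega>(2)[OF \<delta> v2]] by blast
      show "e \<in> orth \<Omega> S u O orth \<Omega> S v O orth \<Omega> S w"
        using closed[OF \<beta> \<delta> \<epsilon>] \<beta> \<delta> \<epsilon> \<alpha> by blast
    qed
  qed
  thus False using assms(3) unfolding exceptional_def by blast
qed

end
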